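(* Let $m$ be a positive integer. In each of the following cases the displayed identity holds, and the triple consisting of $n_1=6m+2$ and the denominators $n_2,n_3$ of the second and third unit fractions on the right-hand side is a wild solution of the Erdős–Straus equation for $24m+1$. (1) If $m=28r-1+c(42r-1)$ with $r\in\mathbb N$, $r>0$, $c\in\mathbb N$, then $$\frac{4}{24m+1}=\frac{1}{6m+2}+\frac{1}{12r(3c+2)(24m+1)}+\frac{1}{12r(3c+2)(42r-1)(24m+1)}.$$ (2) If $m=14r+4+c(42r+13)$ with $r,c\in\mathbb N$, then $$\frac{4}{24m+1}=\frac{1}{6m+2}+\frac{1}{4(3r+1)(3c+1)(24m+1)}+\frac{1}{4(3r+1)(3c+1)(42r+13)(24m+1)}.$$ (3) If $m=7r+3+c(21r+10)$ with $r,c\in\mathbb N$, then $$\frac{4}{24m+1}=\frac{1}{6m+2}+\frac{1}{3(2r+1)(3c+1)(24m+1)}+\frac{1}{6(2r+1)(3c+1)(21r+10)(24m+1)}.$$ (4) If $m=14r+11+c(21r+17)$ with $r,c\in\mathbb N$, then $$\frac{4}{24m+1}=\frac{1}{6m+2}+\frac{1}{(6r+5)(3c+2)(24m+1)}+\frac{1}{2(6r+5)(3c+2)(21r+17)(24m+1)}.$$ (5) If $m=28r+3+c(42r+5)$ with $r\in\mathbb N$, $r>0$, $c\in\mathbb N$, then $$\frac{4}{24m+1}=\frac{1}{6m+2}+\frac{1}{2(6r+1)(3c+2)(24m+1)}+\frac{1}{(6r+1)(3c+2)(42r+5)(24m+1)}.$$ (6) If $m=14r+6+c(42r+19)$ with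 $r,c\in\mathbb N$, then $$\frac{4}{24m+1}=\frac{1}{6m+2}+\frac{1}{6(2r+1)(3c+1)(24m+1)}+\frac{1}{3(2r+1)(3c+1)(42r+19)(24m+1)}.$$
   Context: $\mathbb N$ denotes the set of nonnegative integers. For a positive integer $m$, the Erdős–Straus equation for $n=24m+1$ is $\frac{4}{n}=\frac1{n_1}+\frac1{n_2}+\frac1{n_3}$ in positive integers $n_1,n_2,n_3$. For $n_1=6m+k$ with $1\le k\le 12m$ one has $\frac{4}{24m+1}=\frac{1}{6m+k}+\frac{4k-1}{(6m+k)(24m+1)}$. A solution $(n_1,n_2,n_3)$ is called a wild solution if $n_1=6m+k$ for some integer $1\le k\le 12m$ and there exist an integer $L\ge 2$ (called a multiplier) and positive integers $J_1,J_2$ (called the numerator summands) such that $J_1+J_2=L(4k-1)$, $\gcd(L,J_1,J_2)=1$, $\frac1{n_2}=\frac{J_1}{L(6m+k)(24m+1)}$ and $\frac1{n_3}=\frac{J_2}{L(6m+k)(24m+1)}$. *)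

theory Defs
  imports Complex_Main
begin

definition erdos_straus_solution :: "int \<Rightarrow> int \<Rightarrow> int \<Rightarrow> int \<Rightarrow> bool" where
  "erdos_straus_solution n n1 n2 n3 \<longleftrightarrow>
     n1 > 0 \<and> n2 > 0 \<and> n3 > 0 \<and>
     4 / rat_of_int n = 1 / rat_of_int n1 + 1 / rat_of_int n2 + 1 / rat_of_int n3"

text \<open>Here \<open>L\<close> is the multiplier and \<open>J1\<close>, \<open>J2\<close> are the numerator summands.\<close>

definition wild_solution :: "int \<Rightarrow> int \<Rightarrow> int \<Rightarrow> int \<Rightarrow> bool" where
  "wild_solution m n1 n2 n3 \<longleftrightarrow>
     erdos_straus_solution (24 * m + 1) n1 n2 n3 \<and>
     (\<exists>k. 1 \<le> k \<and> k \<le> 12 * m \<and> n1 = 6 * m + k \<and>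
       (\<exists>L J1 J2. L \<ge> 2 \<and> J1 > 0 \<and> J2 > 0 \<and>
          J1 + J2 = L * (4 * k - 1) \<and>
          gcd L (gcd J1 J2) = 1 \<and>
          1 / rat_of_int n2 = rat_of_int J1 / rat_of_int (L * (6 * m + k) * (24 * m + 1)) \<and>
          1 / rat_of_int n3 = rat_of_int J2 / rat_of_int (L * (6 * m + k) * (24 * m + 1))))"

end

theory Submission
  imports Defs
begin

text \<open>Take \<open>k = 2\<close>. In every family \<open>6 * m + 2\<close> splits as a product of \<open>2\<close>, the factor linear in
  \<open>r\<close> and \<open>3 * c + 1\<close> or \<open>3 * c + 2\<close>. Cancelling the common factors leaves the second and third
  fractions, up to the factor \<open>1 / ((6 * m + 2) * (24 * m + 1))\<close>, as \<open>(7 * L - J) / L\<close> and \<open>J / L\<close>, where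
  \<open>L\<close> is linear in \<open>r\<close> and \<open>J\<close> is \<open>1\<close>, or \<open>J = 2\<close> with \<open>L\<close> odd.\<close>

text \<open>Over the common denominator \<open>L * (6 * m + k) * (24 * m + 1)\<close> the numerators
  add up to \<open>L * (4 * k - 1)\<close>, so \<open>L\<close> cancels and the sum is
  \<open>4 / (24 * m + 1) - 1 / (6 * m + k)\<close>. The conditions on \<open>n2\<close> and
  \<open>n3\<close> are integer products, so a caller checks them without division or a separate
  positivity argument.\<close>

lemma wild_solutionI:
  fixes m k L J1 J2 n2 n3 :: int
  assumes "1 \<le> k" "k \<le> 12 * m"
    and "L \<ge> 2" "J1 > 0" "J2 > 0"
    and sum: "J1 + J2 = L * (4 * k - 1)"
    and "gcd L (gcd J1 J2) = 1"
    and n2: "n2 * J1 = L * (6 * m + k) * (24 * m + 1)"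
    and n3: "n3 * J2 = L * (6 * m + k) * (24 * m + 1)"
  shows "wild_solution m (6 * m + k) n2 n3"
proof -
  define D where "D = L * (6 * m + k) * (24 * m + 1)"
  have pos: "m > 0" "6 * m + k > 0" "24 * m + 1 > 0" using assms(1,2) by auto
  then have "D > 0" using \<open>L \<ge> 2\<close> by (simp add: D_def)
  have quot: "n > 0 \<and> 1 / rat_of_int n = rat_of_int J / rat_of_int D" if "n * J = D" "J > 0" for n J
  proof -
    have "n * J > 0" using that(1) \<open>D > 0\<close> by simp
    then have "n > 0" using that(2) by (rule zero_less_mult_pos2)
    then show ?thesis using that by (simp flip: that(1))
  qed
  note q2 = quot[OF n2[folded D_def] \<open>J1 > 0\<close>] and q3 = quot[OF n3[folded D_def] \<open>J2 > 0\<close>]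
  have "1 / rat_of_int n2 + 1 / rat_of_int n3 = rat_of_int (L * (4 * k - 1)) / rat_of_int D"
    using q2 q3 by (simp add: add_divide_distrib flip: sum)
  also have "\<dots> = rat_of_int (4 * k - 1) / rat_of_int ((6 * m + k) * (24 * m + 1))"
    using \<open>L \<ge> 2\<close> by (simp add: D_def mult.assoc del: of_int_add of_int_diff)
  also have "\<dots> = 4 / rat_of_int (24 * m + 1) - 1 / rat_of_int (6 * m + k)"
  proof -
    \<comment> \<open>Writing the numerator through the two factors of the denominator gives the
      partial fractions. The casts of sums stay folded below so that each factor cancels as a
      unit.\<close>
    have "rat_of_int (4 * k - 1) = 4 * rat_of_int (6 * m + k) - rat_of_int (24 * m + 1)" by simp
    moreover have "rat_of_int (6 * m + k) \<noteq> 0" "rat_of_int (24 * m + 1) \<noteq> 0"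
      using pos(2,3) by (metis of_int_eq_0_iff order_less_irrefl)+
    ultimately show ?thesis by (simp add: diff_divide_distrib del: of_int_add of_int_diff)
  qed
  finally have "4 / rat_of_int (24 * m + 1) =
      1 / rat_of_int (6 * m + k) + 1 / rat_of_int n2 + 1 / rat_of_int n3"
    by (simp only: eq_diff_eq add_ac)
  then have "erdos_straus_solution (24 * m + 1) (6 * m + k) n2 n3"
    unfolding erdos_straus_solution_def using pos q2 q3 by blast
  then show ?thesis
    unfolding wild_solution_def using assms q2 q3
    by (intro conjI exI[of _ k] exI[of _ L] exI[of _ J1] exI[of _ J2]) (simp_all only: D_def)
qed

text \<open>For \<open>k = 2\<close> the summands add up to \<open>7 * L\<close>, so one parameter
  \<open>J\<close> fixes both. The variable \<open>t\<close> receives a factored form of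
  \<open>6 * m + 2\<close>, which makes the last two premises polynomial identities.\<close>

lemma wild_solution_2I:
  fixes m t L J n2 n3 :: int
  assumes "m > 0" "L \<ge> 2" "J > 0" "J < 7 * L" "coprime L J"
    and "6 * m + 2 = t"
    and "n2 * (7 * L - J) = L * t * (24 * m + 1)"
    and "n3 * J = L * t * (24 * m + 1)"
  shows "4 / rat_of_int (24 * m + 1) =
      1 / rat_of_int (6 * m + 2) + 1 / rat_of_int n2 + 1 / rat_of_int n3 \<and>
    wild_solution m (6 * m + 2) n2 n3"
proof -
  \<comment> \<open>Moving \<open>7 * L - J\<close> outward leaves \<open>gcd L J = 1\<close>
    inside.\<close>
  have "gcd L (gcd (7 * L - J) J) = 1"
    using \<open>coprime L J\<close> by (simp add: gcd.left_commute[of L] coprime_iff_gcd_eq_1)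
  then have "wild_solution m (6 * m + 2) n2 n3"
    using assms by (intro wild_solutionI[where L = L and ?J1.0 = "7 * L - J" and ?J2.0 = J]) auto
  then show ?thesis unfolding wild_solution_def erdos_straus_solution_def by blast
qed

theorem theorem3p2:
  fixes m :: int
  assumes "m > 0"
  shows
    "(\<forall>r c :: int. r > 0 \<and> c \<ge> 0 \<and> m = 28 * r - 1 + c * (42 * r - 1) \<longrightarrow>
      4 / rat_of_int (24 * m + 1) =
        1 / rat_of_int (6 * m + 2)
        + 1 / rat_of_int (12 * r * (3 * c + 2) * (24 * m + 1))
        + 1 / rat_of_int (12 * r * (3 * c + 2) * (42 * r - 1) * (24 * m + 1)) \<and>
      wild_solution m (6 * m + 2)
        (12 * r * (3 * c + 2) * (24 * m + 1))
        (12 * r * (3 * c + 2) * (42 * r - 1) * (24 * m + 1))) \<and>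
     (\<forall>r c :: int. r \<ge> 0 \<and> c \<ge> 0 \<and> m = 14 * r + 4 + c * (42 * r + 13) \<longrightarrow>
      4 / rat_of_int (24 * m + 1) =
        1 / rat_of_int (6 * m + 2)
        + 1 / rat_of_int (4 * (3 * r + 1) * (3 * c + 1) * (24 * m + 1))
        + 1 / rat_of_int (4 * (3 * r + 1) * (3 * c + 1) * (42 * r + 13) * (24 * m + 1)) \<and>
      wild_solution m (6 * m + 2)
        (4 * (3 * r + 1) * (3 * c + 1) * (24 * m + 1))
        (4 * (3 * r + 1) * (3 * c + 1) * (42 * r + 13) * (24 * m + 1))) \<and>
     (\<forall>r c :: int. r \<ge> 0 \<and> c \<ge> 0 \<and> m = 7 * r + 3 + c * (21 * r + 10) \<longrightarrow>
      4 / rat_of_int (24 * m + 1) =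
        1 / rat_of_int (6 * m + 2)
        + 1 / rat_of_int (3 * (2 * r + 1) * (3 * c + 1) * (24 * m + 1))
        + 1 / rat_of_int (6 * (2 * r + 1) * (3 * c + 1) * (21 * r + 10) * (24 * m + 1)) \<and>
      wild_solution m (6 * m + 2)
        (3 * (2 * r + 1) * (3 * c + 1) * (24 * m + 1))
        (6 * (2 * r + 1) * (3 * c + 1) * (21 * r + 10) * (24 * m + 1))) \<and>
     (\<forall>r c :: int. r \<ge> 0 \<and> c \<ge> 0 \<and> m = 14 * r + 11 + c * (21 * r + 17) \<longrightarrow>
      4 / rat_of_int (24 * m + 1) =
        1 / rat_of_int (6 * m + 2)
        + 1 / rat_of_int ((6 * r + 5) * (3 * c + 2) * (24 * m + 1))
        + 1 / rat_of_int (2 * (6 * r + 5) * (3 * c + 2) * (21 * r + 17) * (24 * m + 1)) \<and>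
      wild_solution m (6 * m + 2)
        ((6 * r + 5) * (3 * c + 2) * (24 * m + 1))
        (2 * (6 * r + 5) * (3 * c + 2) * (21 * r + 17) * (24 * m + 1))) \<and>
     (\<forall>r c :: int. r > 0 \<and> c \<ge> 0 \<and> m = 28 * r + 3 + c * (42 * r + 5) \<longrightarrow>
      4 / rat_of_int (24 * m + 1) =
        1 / rat_of_int (6 * m + 2)
        + 1 / rat_of_int (2 * (6 * r + 1) * (3 * c + 2) * (24 * m + 1))
        + 1 / rat_of_int ((6 * r + 1) * (3 * c + 2) * (42 * r + 5) * (24 * m + 1)) \<and>
      wild_solution m (6 * m + 2)
        (2 * (6 * r + 1) * (3 * c + 2) * (24 * m + 1))
        ((6 * r + 1) * (3 * c + 2) * (42 * r + 5) * (24 * m + 1))) \<and>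
     (\<forall>r c :: int. r \<ge> 0 \<and> c \<ge> 0 \<and> m = 14 * r + 6 + c * (42 * r + 19) \<longrightarrow>
      4 / rat_of_int (24 * m + 1) =
        1 / rat_of_int (6 * m + 2)
        + 1 / rat_of_int (6 * (2 * r + 1) * (3 * c + 1) * (24 * m + 1))
        + 1 / rat_of_int (3 * (2 * r + 1) * (3 * c + 1) * (42 * r + 19) * (24 * m + 1)) \<and>
      wild_solution m (6 * m + 2)
        (6 * (2 * r + 1) * (3 * c + 1) * (24 * m + 1))
        (3 * (2 * r + 1) * (3 * c + 1) * (42 * r + 19) * (24 * m + 1)))"
\<comment> \<open>In each family \<open>7 * L - J\<close> divides \<open>6 * m + 2\<close>, hence is
  prime to 3. The residues of \<open>L\<close> modulo 6 allowing this are 0, 2, 3, 5 for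
  \<open>J = 1\<close>, and 1, 3 for \<open>J = 2\<close> with \<open>L\<close> odd.\<close>
proof (intro conjI; intro allI impI; elim conjE)
  fix r c :: int
  assume "r > 0" "c \<ge> 0" and m: "m = 28 * r - 1 + c * (42 * r - 1)"
  \<comment> \<open>Here \<open>42 * r - 1\<close> is \<open>7 * L - 1\<close> for
    \<open>L = 6 * r\<close>. The cofactor is 2 modulo 3 because the product must be 2 modulo
    6.\<close>
  have e: "6 * m + 2 = 2 * (42 * r - 1) * (3 * c + 2)" unfolding m by (simp add: algebra_simps)
  show "4 / rat_of_int (24 * m + 1) =
        1 / rat_of_int (6 * m + 2)
        + 1 / rat_of_int (12 * r * (3 * c + 2) * (24 * m + 1))
        + 1 / rat_of_int (12 * r * (3 * c + 2) * (42 * r - 1) * (24 * m + 1)) \<and>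
      wild_solution m (6 * m + 2)
        (12 * r * (3 * c + 2) * (24 * m + 1))
        (12 * r * (3 * c + 2) * (42 * r - 1) * (24 * m + 1))"
    by (rule wild_solution_2I[where L = "6 * r" and J = 1, OF \<open>m > 0\<close> _ _ _ _ e])
      (use \<open>r > 0\<close> in \<open>simp_all add: algebra_simps\<close>)
next
  fix r c :: int
  assume "r \<ge> 0" "c \<ge> 0" and m: "m = 14 * r + 4 + c * (42 * r + 13)"
  have e: "6 * m + 2 = 2 * (42 * r + 13) * (3 * c + 1)" unfolding m by (simp add: algebra_simps)
  show "4 / rat_of_int (24 * m + 1) =
        1 / rat_of_int (6 * m + 2)
        + 1 / rat_of_int (4 * (3 * r + 1) * (3 * c + 1) * (24 * m + 1))
        + 1 / rat_of_int (4 * (3 * r + 1) * (3 * c + 1) * (42 * r + 13) * (24 * m + 1)) \<and>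
      wild_solution m (6 * m + 2)
        (4 * (3 * r + 1) * (3 * c + 1) * (24 * m + 1))
        (4 * (3 * r + 1) * (3 * c + 1) * (42 * r + 13) * (24 * m + 1))"
    by (rule wild_solution_2I[where L = "6 * r + 2" and J = 1, OF \<open>m > 0\<close> _ _ _ _ e])
      (use \<open>r \<ge> 0\<close> in \<open>simp_all add: algebra_simps\<close>)
next
  fix r c :: int
  assume "r \<ge> 0" "c \<ge> 0" and m: "m = 7 * r + 3 + c * (21 * r + 10)"
  have e: "6 * m + 2 = 2 * (21 * r + 10) * (3 * c + 1)" unfolding m by (simp add: algebra_simps)
  show "4 / rat_of_int (24 * m + 1) =
        1 / rat_of_int (6 * m + 2)
        + 1 / rat_of_int (3 * (2 * r + 1) * (3 * c + 1) * (24 * m + 1))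
        + 1 / rat_of_int (6 * (2 * r + 1) * (3 * c + 1) * (21 * r + 10) * (24 * m + 1)) \<and>
      wild_solution m (6 * m + 2)
        (3 * (2 * r + 1) * (3 * c + 1) * (24 * m + 1))
        (6 * (2 * r + 1) * (3 * c + 1) * (21 * r + 10) * (24 * m + 1))"
    \<comment> \<open>Now \<open>7 * L - 1 = 2 * (21 * r + 10)\<close> absorbs the factor 2 of
      \<open>6 * m + 2\<close>, so \<open>n2\<close> is just
      \<open>L * (3 * c + 1) * (24 * m + 1)\<close>.\<close>
    by (rule wild_solution_2I[where L = "6 * r + 3" and J = 1, OF \<open>m > 0\<close> _ _ _ _ e])
      (use \<open>r \<ge> 0\<close> in \<open>simp_all add: algebra_simps\<close>)
next
  fix r c :: int
  assume "r \<ge> 0" "c \<ge> 0" and m: "m = 14 * r + 11 + c * (21 * r + 17)"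
  have e: "6 * m + 2 = 2 * (21 * r + 17) * (3 * c + 2)" unfolding m by (simp add: algebra_simps)
  show "4 / rat_of_int (24 * m + 1) =
        1 / rat_of_int (6 * m + 2)
        + 1 / rat_of_int ((6 * r + 5) * (3 * c + 2) * (24 * m + 1))
        + 1 / rat_of_int (2 * (6 * r + 5) * (3 * c + 2) * (21 * r + 17) * (24 * m + 1)) \<and>
      wild_solution m (6 * m + 2)
        ((6 * r + 5) * (3 * c + 2) * (24 * m + 1))
        (2 * (6 * r + 5) * (3 * c + 2) * (21 * r + 17) * (24 * m + 1))"
    by (rule wild_solution_2I[where L = "6 * r + 5" and J = 1, OF \<open>m > 0\<close> _ _ _ _ e])
      (use \<open>r \<ge> 0\<close> in \<open>simp_all add: algebra_simps\<close>)
next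
  fix r c :: int
  assume "r > 0" "c \<ge> 0" and m: "m = 28 * r + 3 + c * (42 * r + 5)"
  have e: "6 * m + 2 = 2 * (42 * r + 5) * (3 * c + 2)" unfolding m by (simp add: algebra_simps)
  show "4 / rat_of_int (24 * m + 1) =
        1 / rat_of_int (6 * m + 2)
        + 1 / rat_of_int (2 * (6 * r + 1) * (3 * c + 2) * (24 * m + 1))
        + 1 / rat_of_int ((6 * r + 1) * (3 * c + 2) * (42 * r + 5) * (24 * m + 1)) \<and>
      wild_solution m (6 * m + 2)
        (2 * (6 * r + 1) * (3 * c + 2) * (24 * m + 1))
        ((6 * r + 1) * (3 * c + 2) * (42 * r + 5) * (24 * m + 1))"
    \<comment> \<open>With \<open>J = 2\<close> the factor 2 of \<open>6 * m + 2\<close> cancels in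
      \<open>n3\<close> instead. Coprimality holds as \<open>L\<close> is odd, and
      \<open>r > 0\<close> excludes \<open>L = 1\<close>.\<close>
    by (rule wild_solution_2I[where L = "6 * r + 1" and J = 2, OF \<open>m > 0\<close> _ _ _ _ e])
      (use \<open>r > 0\<close> in \<open>simp_all add: algebra_simps\<close>)
next
  fix r c :: int
  assume "r \<ge> 0" "c \<ge> 0" and m: "m = 14 * r + 6 + c * (42 * r + 19)"
  have e: "6 * m + 2 = 2 * (42 * r + 19) * (3 * c + 1)" unfolding m by (simp add: algebra_simps)
  show "4 / rat_of_int (24 * m + 1) =
        1 / rat_of_int (6 * m + 2)
        + 1 / rat_of_int (6 * (2 * r + 1) * (3 * c + 1) * (24 * m + 1))
        + 1 / rat_of_int (3 * (2 * r + 1) * (3 * c + 1) * (42 * r + 19) * (24 * m + 1)) \<and>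
      wild_solution m (6 * m + 2)
        (6 * (2 * r + 1) * (3 * c + 1) * (24 * m + 1))
        (3 * (2 * r + 1) * (3 * c + 1) * (42 * r + 19) * (24 * m + 1))"
    by (rule wild_solution_2I[where L = "6 * r + 3" and J = 2, OF \<open>m > 0\<close> _ _ _ _ e])
      (use \<open>r \<ge> 0\<close> in \<open>simp_all add: algebra_simps\<close>)
qed

end
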